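(* For every integer $m\ge 0$, the following identities hold in $\mathbf U$: \[ t_{\mathrm{ev}}^{(2m)} = \sum_{c=0}^m \sum_{a=0}^{2m-2c} q^{\binom{2c+1}{2} -a(2m-2c-a)} \check E^{(a)} \begin{bmatrix} h;1-m\\ c\end{bmatrix} F^{(2m-2c-a)} + \sum_{c=0}^{m-1} \sum_{a=0}^{2m-1-2c} q^{\binom{2c+2}{2}-2m -a(2m-1-2c-a)} \check E^{(a)} \begin{bmatrix} h;1-m\\ c\end{bmatrix} K^{-1} F^{(2m-1-2c-a)}, \] \[ t_{\mathrm{ev}}^{(2m+1)} = \sum_{c=0}^{m} \sum_{a=0}^{2m+1-2c} q^{\binom{2c}{2} -a(2m+1-2c-a)} \check E^{(a)} \begin{bmatrix} h;1-m\\ c\end{bmatrix} F^{(2m+1-2c-a)} +\sum_{c=0}^m \sum_{a=0}^{2m-2c} q^{\binom{2c+1}{2}-2m -a(2m-2c-a)} \check E^{(a)} \begin{bmatrix} h;1-m\\ c\end{bmatrix} K^{-1} F^{(2m-2c-a)}. \]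
   Context: $\mathbf U=\mathbf U_q(\mathfrak{sl}_2)$ is the $\mathbb Q(q)$-algebra generated by $E,F,K,K^{-1}$ with relations $KK^{-1}=K^{-1}K=1$, $EF-FE=\frac{K-K^{-1}}{q-q^{-1}}$, $KE=q^2EK$, $KF=q^{-2}FK$. For $n\in\mathbb Z$, $[n]=\frac{q^n-q^{-n}}{q-q^{-1}}$, and $[n]!=[1][2]\cdots[n]$ for $n\ge 0$ (with $[0]!=1$). Put $\check E=q^{-1}EK^{-1}$, $t=\check E+F+K^{-1}$, and $\check E^{(n)}=\check E^n/[n]!$, $F^{(n)}=F^n/[n]!$ for $n\ge 0$. (The symbol $h$ stands for $h=\frac{K^{-2}-1}{q^2-1}$.) For $a\in\mathbb Z$, $n\ge 0$, \[ \begin{bmatrix} h;a\\ n\end{bmatrix}=\prod_{i=1}^n\frac{q^{4a+4i-4}K^{-2}-1}{q^{4i}-1} \] (an empty product is $1$). In exponents, $\binom{x}{2}=x(x-1)/2$ for integers $x$. Empty sums are $0$. The $\imath$-divided powers $t_{\mathrm{ev}}^{(n)}$ are the polynomials in $t$ determined by $t_{\mathrm{ev}}^{(0)}=1$, $t_{\mathrm{ev}}^{(1)}=t$, and, for $a\ge 0$: $t\cdot t_{\mathrm{ev}}^{(2a)}=[2a+1]\,t_{\mathrm{ev}}^{(2a+1)}$, $t\cdot t_{\mathrm{ev}}^{(2a+1)}=[2a+2]\,t_{\mathrm{ev}}^{(2a+2)}+[2a+1]\,t_{\mathrm{ev}}^{(2a)}$. Equivalently, $t_{\mathrm{ev}}^{(2a)}=\frac{1}{[2a]!}\prod_{i=1-a}^{a}(t-[2i-1])$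 and $t_{\mathrm{ev}}^{(2a+1)}=\frac{1}{[2a+1]!}\,t\prod_{i=1-a}^{a}(t-[2i-1])$. *)

theory Defs
  imports "HOL-Computational_Algebra.Computational_Algebra" "HOL-Library.Poly_Mapping"
begin

section \<open>The ground field of rational functions over the rationals\<close>

type_synonym ratfun = "rat poly fract"

definition q :: ratfun where
  "q = to_fract [:0, 1:]"

definition qint :: "int \<Rightarrow> ratfun" where
  "qint n = (q powi n - q powi (- n)) / (q - inverse q)"

definition qfact :: "nat \<Rightarrow> ratfun" where
  "qfact n = (\<Prod>i = 1..n. qint (int i))"

lemma q_power: "q ^ n = to_fract (monom 1 n)"
proof (induction n)
  case 0
  show ?case by simp
next
  case (Suc n)
  have "q ^ Suc n = to_fract ([:0, 1:] * monom 1 n)"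
    by (simp only: power_Suc Suc.IH to_fract_mult) (simp only: q_def)
  also have "[:0, 1:] * monom (1::rat) n = monom 1 (Suc n)"
    by (simp add: monom_Suc)
  finally show ?case .
qed

lemma q_nonzero [simp]: "q \<noteq> 0"
  by (simp add: q_def)

lemma q_power_neq_1: "n > 0 \<Longrightarrow> q ^ n \<noteq> 1"
  by (metis degree_1 degree_monom_eq less_irrefl one_neq_zero q_power to_fract_1 to_fract_eq_iff)

lemma qint_nonzero: "n > 0 \<Longrightarrow> qint (int n) \<noteq> 0"
proof -
  have *: "q ^ k - inverse (q ^ k) \<noteq> 0" if "k > 0" for k
  proof
    assume "q ^ k - inverse (q ^ k) = 0"
    then have "q ^ k * q ^ k = 1"
      by (metis eq_iff_diff_eq_0 power_not_zero q_nonzero right_inverse)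
    then have "q ^ (k + k) = 1"
      by (simp add: power_add)
    with q_power_neq_1 [of "k + k"] that show False
      by simp
  qed
  show "n > 0 \<Longrightarrow> qint (int n) \<noteq> 0"
    using *[of n] *[of 1] by (simp add: qint_def power_int_minus)
qed


section \<open>The free algebra on the four generators\<close>

datatype gen = GE | GF | GK | GKinv

datatype word = Word (letters: "gen list")

instantiation word :: monoid_add
begin

definition zero_word :: word where
  "0 = Word []"

definition plus_word :: "word \<Rightarrow> word \<Rightarrow> word" where
  "v + w = Word (letters v @ letters w)"

instance
  by standard (simp_all add: zero_word_def plus_word_def)

end

text \<open>
  The monoid of words is written additively because the product of
  theory \<open>Poly_Mapping\<close> is convolution with respect to addition of exponents.
  So \<open>word \<Rightarrow>\<^sub>0 ratfun\<close> is the monoid algebra of the free monoid, that is, the free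
  associative algebra.
\<close>

type_synonym free = "word \<Rightarrow>\<^sub>0 ratfun"

definition const :: "ratfun \<Rightarrow> free" where
  "const c = Poly_Mapping.single 0 c"

definition var :: "gen \<Rightarrow> free" where
  "var g = Poly_Mapping.single (Word [g]) 1"


section \<open>Quantum sl(2)\<close>

inductive_set relators :: "free set" where
  "var GK * var GKinv - 1 \<in> relators"
| "var GKinv * var GK - 1 \<in> relators"
| "var GE * var GF - var GF * var GE
     - const (1 / (q - inverse q)) * (var GK - var GKinv) \<in> relators"
| "var GK * var GE - const (q powi 2) * (var GE * var GK) \<in> relators"
| "var GK * var GF - const (q powi (- 2)) * (var GF * var GK) \<in> relators"

inductive_set rel_ideal :: "free set" where
  gen: "x \<in> relators \<Longrightarrow> x \<in> rel_ideal"
| add: "x \<in> rel_ideal \<Longrightarrow> y \<in> rel_ideal \<Longrightarrow> x + y \<in> rel_ideal"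
| left: "x \<in> rel_ideal \<Longrightarrow> z * x \<in> rel_ideal"
| right: "x \<in> rel_ideal \<Longrightarrow> x * z \<in> rel_ideal"

lemma rel_ideal_zero: "0 \<in> rel_ideal"
  using rel_ideal.left [OF rel_ideal.gen [OF relators.intros(1)], of 0] by simp

lemma rel_ideal_uminus: "x \<in> rel_ideal \<Longrightarrow> - x \<in> rel_ideal"
  using rel_ideal.left [of x "- 1"] by simp

definition rel_eq :: "free \<Rightarrow> free \<Rightarrow> bool" where
  "rel_eq x y \<longleftrightarrow> x - y \<in> rel_ideal"

lemma equivp_rel_eq: "equivp rel_eq"
proof (rule equivpI)
  show "reflp rel_eq"
    by (simp add: reflp_def rel_eq_def rel_ideal_zero)
  show "symp rel_eq"
    unfolding symp_def rel_eq_def by (metis minus_diff_eq rel_ideal_uminus)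
  show "transp rel_eq"
    unfolding transp_def rel_eq_def
  proof (intro allI impI)
    fix x y z :: free assume "x - y \<in> rel_ideal" "y - z \<in> rel_ideal"
    then have "(x - y) + (y - z) \<in> rel_ideal"
      by (rule rel_ideal.add)
    then show "x - z \<in> rel_ideal"
      by simp
  qed
qed

text \<open>
  The augmentation (counit) of the free algebra kills the ideal but not 1, so that the
  quotient is not the zero ring.
\<close>

definition aug_gen :: "gen \<Rightarrow> ratfun" where
  "aug_gen g = (if g = GK \<or> g = GKinv then 1 else 0)"

definition aug_word :: "word \<Rightarrow> ratfun" where
  "aug_word w = prod_list (map aug_gen (letters w))"

definition aug :: "free \<Rightarrow> ratfun" where
  "aug x = (\<Sum>w\<in>Poly_Mapping.keys x. Poly_Mapping.lookup x w * aug_word w)"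

lemma aug_superset:
  assumes "finite S" "Poly_Mapping.keys x \<subseteq> S"
  shows "aug x = (\<Sum>w\<in>S. Poly_Mapping.lookup x w * aug_word w)"
  unfolding aug_def by (rule sum.mono_neutral_left) (use assms in \<open>auto simp: Poly_Mapping.in_keys_iff\<close>)

lemma aug_single: "aug (Poly_Mapping.single w c) = c * aug_word w"
  using aug_superset [of "{w}" "Poly_Mapping.single w c"] by simp

lemma aug_add: "aug (x + y) = aug x + aug y"
proof -
  let ?S = "Poly_Mapping.keys x \<union> Poly_Mapping.keys y"
  have "Poly_Mapping.keys (x + y) \<subseteq> ?S"
    by (rule Poly_Mapping.keys_add)
  then show ?thesis
    by (simp add: aug_superset [of ?S] Poly_Mapping.lookup_add sum.distrib distrib_right)
qed

lemma aug_diff: "aug (x - y) = aug x - aug y"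
  using aug_add [of "x - y" y] by simp

lemma free_induct [case_names zero single_add]:
  fixes x :: free
  assumes "P 0" and "\<And>w c y. P y \<Longrightarrow> P (Poly_Mapping.single w c + y)"
  shows "P x"
proof (induction x rule: Poly_Mapping.update_induct)
  case const
  show ?case by (fact assms(1))
next
  case (update f a b)
  have "Poly_Mapping.update a b f = Poly_Mapping.single a b + f"
    using update by (intro Poly_Mapping.poly_mapping_eqI)
      (auto simp: Poly_Mapping.lookup_update Poly_Mapping.lookup_add Poly_Mapping.lookup_single Poly_Mapping.in_keys_iff when_def)
  with update assms(2) show ?case by simp
qed

lemma aug_word_add: "aug_word (v + w) = aug_word v * aug_word w"
  by (simp add: aug_word_def plus_word_def)

lemma aug_zero: "aug 0 = 0"
  by (simp add: aug_def)

lemma aug_mult_single: "aug (Poly_Mapping.single v c * y) = c * aug_word v * aug y"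
  by (induction y rule: free_induct)
    (simp_all add: aug_zero aug_add aug_single aug_word_add mult_single algebra_simps)

lemma aug_mult: "aug (x * y) = aug x * aug y"
  by (induction x rule: free_induct)
    (simp_all add: aug_zero aug_add aug_single aug_mult_single distrib_right)

lemma aug_one: "aug 1 = 1"
proof -
  have "aug_word 0 = 1"
    by (simp add: aug_word_def zero_word_def)
  with aug_single [of 0 1] show ?thesis
    by simp
qed

lemma aug_var: "aug (var g) = aug_gen g"
  by (simp add: var_def aug_single aug_word_def)

lemma aug_relators: "x \<in> relators \<Longrightarrow> aug x = 0"
  by (induction rule: relators.induct) (simp_all add: aug_diff aug_mult aug_one aug_var aug_gen_def)

lemma aug_rel_ideal: "x \<in> rel_ideal \<Longrightarrow> aug x = 0"
  by (induction rule: rel_ideal.induct) (simp_all add: aug_relators aug_add aug_mult)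

quotient_type U = free / rel_eq
  by (rule equivp_rel_eq)

instantiation U :: ring_1
begin

lift_definition zero_U :: U is 0 .

lift_definition one_U :: U is 1 .

lift_definition plus_U :: "U \<Rightarrow> U \<Rightarrow> U" is "(+)"
  unfolding rel_eq_def
proof -
  fix a b c d assume "a - b \<in> rel_ideal" "c - d \<in> rel_ideal"
  then have "(a - b) + (c - d) \<in> rel_ideal"
    by (rule rel_ideal.add)
  then show "(a + c) - (b + d) \<in> rel_ideal"
    by (simp add: algebra_simps)
qed

lift_definition uminus_U :: "U \<Rightarrow> U" is uminus
  unfolding rel_eq_def using rel_ideal_uminus by fastforce

lift_definition minus_U :: "U \<Rightarrow> U \<Rightarrow> U" is "(-)"
proof -
  fix a b c d assume "rel_eq a b" "rel_eq c d"
  then have "(a - b) + - (c - d) \<in> rel_ideal"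
    unfolding rel_eq_def by (intro rel_ideal.add rel_ideal_uminus)
  then show "rel_eq (a - c) (b - d)"
    by (simp add: rel_eq_def algebra_simps)
qed

lift_definition times_U :: "U \<Rightarrow> U \<Rightarrow> U" is "(*)"
proof -
  fix a b c d assume "rel_eq a b" "rel_eq c d"
  then have "(a - b) * c + b * (c - d) \<in> rel_ideal"
    unfolding rel_eq_def by (intro rel_ideal.add rel_ideal.left rel_ideal.right)
  then show "rel_eq (a * c) (b * d)"
    by (simp add: rel_eq_def algebra_simps)
qed

instance
proof
  show "(0::U) \<noteq> 1"
  proof (transfer, rule notI)
    assume "rel_eq 0 1"
    then have "aug (0 - 1) = 0"
      unfolding rel_eq_def by (rule aug_rel_ideal)
    then show False
      by (simp add: aug_diff aug_zero aug_one del: diff_0)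
  qed
qed (transfer; simp add: rel_eq_def algebra_simps rel_ideal_zero)+

end

lift_definition scale :: "ratfun \<Rightarrow> U \<Rightarrow> U" (infixr \<open>*\<^sub>q\<close> 75) is "\<lambda>c x. const c * x"
  unfolding rel_eq_def by (metis right_diff_distrib rel_ideal.left)

lift_definition E :: U is "var GE" .
lift_definition F :: U is "var GF" .
lift_definition K :: U is "var GK" .
lift_definition Kinv :: U is "var GKinv" .

lemma rel_eq_relators: "x - y \<in> relators \<Longrightarrow> rel_eq x y"
  unfolding rel_eq_def by (rule rel_ideal.gen)

lemma U_relations:
  "K * Kinv = 1"
  "Kinv * K = 1"
  "E * F - F * E = (1 / (q - inverse q)) *\<^sub>q (K - Kinv)"
  "K * E = (q powi 2) *\<^sub>q (E * K)"
  "K * F = (q powi (- 2)) *\<^sub>q (F * K)"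
proof -
  show "K * Kinv = 1"
    by transfer (rule rel_eq_relators, rule relators.intros)
  show "Kinv * K = 1"
    by transfer (rule rel_eq_relators, rule relators.intros)
  show "E * F - F * E = (1 / (q - inverse q)) *\<^sub>q (K - Kinv)"
    by transfer (rule rel_eq_relators, rule relators.intros)
  show "K * E = (q powi 2) *\<^sub>q (E * K)"
    by transfer (rule rel_eq_relators, rule relators.intros)
  show "K * F = (q powi (- 2)) *\<^sub>q (F * K)"
    by transfer (rule rel_eq_relators, rule relators.intros)
qed

lemma const_commute: "const c * x = x * const c"
  by (induction x rule: free_induct)
    (simp_all add: const_def mult_single distrib_left distrib_right mult.commute)

lemma scale_algebra:
  "c *\<^sub>q (x + y) = c *\<^sub>q x + c *\<^sub>q y"
  "(c + d) *\<^sub>q x = c *\<^sub>q x + d *\<^sub>q x"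
  "c *\<^sub>q (d *\<^sub>q x) = (c * d) *\<^sub>q x"
  "1 *\<^sub>q x = x"
  "(c *\<^sub>q x) * y = c *\<^sub>q (x * y)"
  "x * (c *\<^sub>q y) = c *\<^sub>q (x * y)"
proof -
  have eq: "rel_eq y z" if "y = z" for y z
    using that by (simp add: rel_eq_def rel_ideal_zero)
  show "c *\<^sub>q (x + y) = c *\<^sub>q x + c *\<^sub>q y"
    by transfer (simp add: eq distrib_left)
  show "(c + d) *\<^sub>q x = c *\<^sub>q x + d *\<^sub>q x"
    by transfer (simp add: eq const_def single_add distrib_right)
  show "c *\<^sub>q (d *\<^sub>q x) = (c * d) *\<^sub>q x"
    by transfer (simp add: eq const_def mult_single flip: mult.assoc)
  show "1 *\<^sub>q x = x"
    by transfer (simp add: eq const_def)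
  show "(c *\<^sub>q x) * y = c *\<^sub>q (x * y)"
    by transfer (simp add: eq mult.assoc)
  show "x * (c *\<^sub>q y) = c *\<^sub>q (x * y)"
    by transfer (rule eq, metis const_commute mult.assoc)
qed


section \<open>Divided powers\<close>

definition Echeck :: U where
  "Echeck = inverse q *\<^sub>q (E * Kinv)"

definition t :: U where
  "t = Echeck + F + Kinv"

definition dpow :: "U \<Rightarrow> nat \<Rightarrow> U" where
  "dpow x n = inverse (qfact n) *\<^sub>q x ^ n"

text \<open>
  A power of \<open>Kinv\<close> stands for the corresponding negative power of \<open>K\<close>.  The factors
  commute with each other, so the order of the list product is immaterial.
\<close>

definition hbinom :: "int \<Rightarrow> nat \<Rightarrow> U" where
  "hbinom a n =
     (\<Prod>i\<leftarrow>[1..<Suc n].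
        inverse (q ^ (4 * i) - 1) *\<^sub>q ((q powi (4 * a + 4 * int i - 4)) *\<^sub>q Kinv ^ 2 - 1))"

text \<open>
  The even iota-divided powers: the defining recurrences, stated below as
  \<open>t_ev_recurrences\<close>, solved for the term of highest index.
\<close>

fun t_ev :: "nat \<Rightarrow> U" where
  "t_ev 0 = 1"
| "t_ev (Suc 0) = t"
| "t_ev (Suc (Suc n)) =
     inverse (qint (int n + 2)) *\<^sub>q
       (if even n then t * t_ev (Suc n) - qint (int n + 1) *\<^sub>q t_ev n
        else t * t_ev (Suc n))"

lemma t_ev_recurrences:
  "t * t_ev (2 * a) = qint (2 * int a + 1) *\<^sub>q t_ev (2 * a + 1)"
  "t * t_ev (2 * a + 1) =
     qint (2 * int a + 2) *\<^sub>q t_ev (2 * a + 2) + qint (2 * int a + 1) *\<^sub>q t_ev (2 * a)"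
proof -
  have nz: "qint (int n + 2) \<noteq> 0" for n
    using qint_nonzero [of "n + 2"] by (simp add: add.commute)
  have one: "qint 1 = 1"
    using qint_nonzero [of 1] by (simp add: qint_def power_int_minus split: if_splits)
  show "t * t_ev (2 * a) = qint (2 * int a + 1) *\<^sub>q t_ev (2 * a + 1)"
  proof (cases a)
    case 0
    then show ?thesis by (simp add: one scale_algebra)
  next
    case (Suc b)
    with nz [of "2 * b + 1"] show ?thesis
      by (simp add: scale_algebra add.commute flip: mult.assoc)
  qed
  show "t * t_ev (2 * a + 1) =
     qint (2 * int a + 2) *\<^sub>q t_ev (2 * a + 2) + qint (2 * int a + 1) *\<^sub>q t_ev (2 * a)"
    using nz [of "2 * a"] by (simp add: scale_algebra)
qed

end

theory Submission
  imports Defs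
begin

text \<open>
  Both formulas are checked against the recurrences that determine the divided powers, by
  induction on \<open>m\<close>. What makes this a short check is the right unit of computation: not single
  normally ordered monomials, but the \<^emph>\<open>layers\<close>
  \<open>L\<^sub>s(P) = \<Sum>\<^bsub>0\<le>a\<le>s\<^esub> q\<^bsup>-a(s-a)\<^esup> Echeck\<^bsup>(a)\<^esup> P F\<^bsup>(s-a)\<^esup>\<close>, with \<open>L\<^sub>s = 0\<close> for \<open>s < 0\<close>,
  for \<open>P\<close> a polynomial in \<open>K\<inverse>\<close>. The claim writes \<open>t_ev (2 * m)\<close> and \<open>t_ev (2 * m + 1)\<close> as combinations
  of the layers \<open>L\<^sub>s(H\<^sub>c)\<close> and \<open>L\<^sub>s(K\<inverse> H\<^sub>c)\<close>, where \<open>H\<^sub>c\<close> is the binomial \<open>hbinom (1 - m) c\<close> and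
  one \<open>s\<close> belongs to each \<open>c\<close>.

  Multiplying a layer by \<open>t\<close> from the left and normally ordering the result gives only coefficients
  that are constant in \<open>a\<close> or proportional to \<open>q\<^bsup>-2a\<^esup>\<close>: the weights \<open>q\<^bsup>-a(s-a)\<^esup>\<close> are chosen for
  this. So \<open>t L\<^sub>s(P)\<close> is a combination of layers of index \<open>s + 1\<close>, \<open>s\<close>, \<open>s - 1\<close> and of
  \<^emph>\<open>twisted\<close> layers \<open>M\<^sub>s\<close>, which carry the extra factor \<open>q\<^bsup>-2a\<^esup>\<close> (\<open>t_layer\<close>). The
  coefficient \<open>P\<close> is replaced there by \<open>P\<close> itself, by its conjugate \<open>P'\<close> with \<open>F P = P' F\<close>, by
  \<open>K\<inverse> P\<close> or by \<open>K\<^sup>-\<^sup>2 P\<close>.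

  Conjugation by \<open>F\<close> sends \<open>H\<^sub>c\<close> to \<open>H'\<^sub>c = hbinom (- m) c\<close>, the binomial of the next even step, and two
  relations of Pascal type express \<open>H\<^sub>c\<^sub>-\<^sub>1\<close> and \<open>K\<^sup>-\<^sup>2 H\<^sub>c\<^sub>-\<^sub>1\<close> linearly by \<open>H\<^sub>c\<close> and \<open>H'\<^sub>c\<close>
  (\<open>hbinom_pascal\<close>, \<open>Kinv_square_hbinom\<close>). Hence all contributions of one index \<open>s\<close> to
  \<open>t\<close> times the claimed sum are combinations of the four elements \<open>L\<^sub>s\<close> and \<open>M\<^sub>s\<close> of \<open>H\<^sub>c\<close> and \<open>H'\<^sub>c\<close>
  (or of these times \<open>K\<inverse>\<close>). The twisted ones cancel and the others add up to the claim
  (\<open>match_layers\<close>), by identities between monomials in \<open>q\<close>. The lemmas \<open>t_even_sum\<close> and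
  \<open>t_odd_sum\<close> collect this into the two recurrences.
\<close>

section \<open>Commutation relations\<close>

interpretation U: vector_space "(*\<^sub>q)"
  by unfold_locales (simp_all add: scale_algebra)

lemma scale_mult_left: "(c *\<^sub>q x) * y = c *\<^sub>q (x * y)"
  and scale_mult_right: "x * (c *\<^sub>q y) = c *\<^sub>q (x * y)"
  by (simp_all add: scale_algebra)

lemma Kinv_E: "Kinv * E = q powi (-2) *\<^sub>q (E * Kinv)"
proof -
  have "E * Kinv = Kinv * (K * E) * Kinv"
    by (simp add: U_relations(1,2) mult.assoc) (simp add: U_relations(2) flip: mult.assoc)
  also have "\<dots> = q powi 2 *\<^sub>q (Kinv * E)"
    unfolding U_relations by (simp add: scale_mult_left scale_mult_right mult.assoc U_relations)
  finally show ?thesis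
    by (simp add: power_int_minus)
qed

lemma F_Kinv: "F * Kinv = q powi (-2) *\<^sub>q (Kinv * F)"
proof -
  have "F * Kinv = Kinv * (K * F) * Kinv"
    by (simp add: U_relations(1,2) mult.assoc) (simp add: U_relations(2) flip: mult.assoc)
  also have "\<dots> = q powi (-2) *\<^sub>q (Kinv * F)"
    unfolding U_relations by (simp add: scale_mult_left scale_mult_right mult.assoc U_relations)
  finally show ?thesis .
qed

lemma Kinv_Echeck: "Kinv * Echeck = q powi (-2) *\<^sub>q (Echeck * Kinv)"
  by (simp add: Echeck_def scale_mult_left scale_mult_right Kinv_E mult.commute flip: mult.assoc)

lemma q_square_neq_1: "q\<^sup>2 \<noteq> 1"
  by (rule q_power_neq_1) simp

lemma q_square_minus_1: "q\<^sup>2 - 1 \<noteq> 0"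
  using q_square_neq_1 by simp

lemma q_square_mult: "q\<^sup>2 * q powi e = q powi (e + 2)" "q powi e * q\<^sup>2 = q powi (e + 2)"
  by (simp_all add: power_int_add)

lemma q_neq_inverse: "q - inverse q \<noteq> 0"
  using q_square_neq_1 by (auto simp: power2_eq_square field_simps)

text \<open>
  The last term is the element \<open>h = (K\<^sup>-\<^sup>2 - 1) / (q\<^sup>2 - 1)\<close>, so \<open>F\<close> and \<open>Echeck\<close> \<open>q\<close>-commute up to
  \<open>h\<close>, and only \<open>K\<inverse>\<close> occurs when monomials in them are reordered.
\<close>

lemma F_Echeck:
  "F * Echeck = q powi (-2) *\<^sub>q (Echeck * F) + (1 / (q\<^sup>2 - 1)) *\<^sub>q (Kinv\<^sup>2 - 1)"
proof -
  have "F * E = E * F - (1 / (q - inverse q)) *\<^sub>q (K - Kinv)"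
    using U_relations(3) by (metis diff_diff_eq2 add_diff_cancel_left')
  then have "F * E * Kinv = E * (F * Kinv) - (1 / (q - inverse q)) *\<^sub>q (1 - Kinv\<^sup>2)"
    by (simp add: left_diff_distrib scale_mult_left mult.assoc U_relations power2_eq_square)
  then have "F * Echeck = inverse q *\<^sub>q (E * (F * Kinv) - (1 / (q - inverse q)) *\<^sub>q (1 - Kinv\<^sup>2))"
    by (simp add: Echeck_def scale_mult_right mult.assoc)
  also have "\<dots> = q powi (-2) *\<^sub>q (Echeck * F) - (inverse q * (1 / (q - inverse q))) *\<^sub>q (1 - Kinv\<^sup>2)"
    by (simp add: F_Kinv Echeck_def scale_mult_left scale_mult_right mult.assoc
        U.scale_right_diff_distrib mult.commute)
  also have "inverse q * (1 / (q - inverse q)) = 1 / (q\<^sup>2 - 1)"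
    using q_neq_inverse q_square_neq_1 by (simp add: power2_eq_square divide_simps)
  finally show ?thesis
    by (simp add: U.scale_right_diff_distrib)
qed

lemma qint_0 [simp]: "qint 0 = 0"
  by (simp add: qint_def)

text \<open>
  With \<open>q\<^sup>2 - 1\<close> as the only denominator, identities between quantum integers become identities between
  sums of powers of \<open>q\<close> once denominators are cleared.
\<close>

lemma qint_eq: "qint n = (q powi (n + 1) - q powi (1 - n)) / (q\<^sup>2 - 1)"
  using q_neq_inverse q_square_neq_1
  by (simp add: qint_def power_int_add power_int_diff power_int_minus field_simps power2_eq_square)

lemma dpow_0 [simp]: "dpow x 0 = 1"
  by (simp add: dpow_def qfact_def)

lemma qfact_Suc: "qfact (Suc n) = qint (int n + 1) * qfact n"
  by (simp add: qfact_def prod.nat_ivl_Suc' add.commute)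

lemma mult_dpow: "x * dpow x n = qint (int n + 1) *\<^sub>q dpow x (Suc n)"
  using qint_nonzero[of "Suc n"]
  by (simp add: dpow_def scale_mult_right qfact_Suc add.commute)

lemma dpow_Suc: "dpow x (Suc n) = inverse (qint (int n + 1)) *\<^sub>q (dpow x n * x)"
  by (simp add: dpow_def scale_mult_left qfact_Suc power_Suc2 del: power_Suc)

lemma Kinv_dpow_Echeck:
  "Kinv * dpow Echeck n = q powi (- 2 * int n) *\<^sub>q (dpow Echeck n * Kinv)"
proof (induction n)
  case (Suc n)
  have "Kinv * dpow Echeck (Suc n)
      = inverse (qint (int n + 1)) *\<^sub>q (Kinv * dpow Echeck n * Echeck)"
    by (simp add: dpow_Suc scale_mult_right mult.assoc)
  also have "\<dots> = (q powi (- 2 * int n) * q powi (-2)) *\<^sub>q (dpow Echeck (Suc n) * Kinv)"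
    unfolding Suc.IH
    by (simp add: scale_mult_left scale_mult_right mult.assoc Kinv_Echeck dpow_Suc ac_simps)
  also have "q powi (- 2 * int n) * q powi (-2) = q powi (- 2 * int (Suc n))"
    by (simp add: algebra_simps flip: power_int_add)
  finally show ?case .
qed simp

text \<open>
  Moving \<open>F\<close> past the factors \<open>Echeck\<close> one by one leaves a copy of \<open>h\<close> in each place; collecting these
  produces a factor \<open>[n + 1]\<close>, which the passage to divided powers absorbs.
\<close>

lemma F_dpow_Echeck_Suc:
  "F * dpow Echeck (Suc n) = q powi (- 2 * int (Suc n)) *\<^sub>q (dpow Echeck (Suc n) * F)
     + (q powi (- int n) / (q\<^sup>2 - 1)) *\<^sub>q (dpow Echeck n * (q powi (- 2 * int n) *\<^sub>q Kinv\<^sup>2 - 1))"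
proof (induction n)
  case 0
  show ?case using q_neq_inverse by (simp add: dpow_Suc F_Echeck qint_def power_int_minus)
next
  case (Suc n)
  let ?E = "dpow Echeck" and ?n = "int n"
  have n2: "qint (?n + 2) \<noteq> 0"
    using qint_nonzero[of "n + 2"] by (simp add: add.commute)
  have hE: "(d *\<^sub>q Kinv\<^sup>2 - 1) * Echeck = Echeck * ((d * q powi (-4)) *\<^sub>q Kinv\<^sup>2 - 1)" for d
  proof -
    have "Kinv\<^sup>2 * Echeck = (q powi (-2) * q powi (-2)) *\<^sub>q (Echeck * Kinv\<^sup>2)"
      by (simp add: power2_eq_square mult.assoc Kinv_Echeck scale_mult_right)
        (simp add: Kinv_Echeck scale_mult_left flip: mult.assoc)
    also have "q powi (-2) * q powi (-2) = q powi (-4)"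
      by (simp flip: power_int_add)
    finally show ?thesis
      by (simp add: left_diff_distrib right_diff_distrib scale_mult_left scale_mult_right)
  qed
  \<comment> \<open>Clears the common denominator \<open>q\<^sup>2 - 1\<close> in the two scalar identities below.\<close>
  have div: "a / d + b / d * (x / d) * c = (y / d) * (g / d * h)"
    if "a * d + b * x * c = y * (g * h)" and "d \<noteq> 0" for a b c d g h x y :: ratfun
    using that by (simp add: divide_simps)
  note div = div[OF _ q_square_minus_1]
  have dd: "dpow Echeck n * Echeck = qint (?n + 1) *\<^sub>q ?E (Suc n)"
    using qint_nonzero[of "Suc n"] by (simp add: dpow_Suc add.commute)
  have ee: "?E (Suc n) * Echeck = qint (?n + 2) *\<^sub>q ?E (Suc (Suc n))"
    using n2 by (simp add: dpow_Suc[of _ "Suc n"] add.commute)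
  have "F * ?E (Suc (Suc n)) = inverse (qint (?n + 2)) *\<^sub>q (F * ?E (Suc n) * Echeck)"
    by (simp add: dpow_Suc[of _ "Suc n"] scale_mult_right mult.assoc add.commute)
  also have "F * ?E (Suc n) * Echeck =
      q powi (- 2 * int (Suc n)) *\<^sub>q (?E (Suc n) * (F * Echeck))
     + (q powi (- ?n) / (q\<^sup>2 - 1)) *\<^sub>q
         (?E n * Echeck * ((q powi (- 2 * ?n) * q powi (-4)) *\<^sub>q Kinv\<^sup>2 - 1))"
    unfolding Suc.IH by (simp add: distrib_right scale_mult_left mult.assoc hE)
  also have "\<dots> = (q powi (- 2 * int (Suc n)) * q powi (-2) * qint (?n + 2)) *\<^sub>q (?E (Suc (Suc n)) * F)
     + (q powi (- 2 * int (Suc n)) / (q\<^sup>2 - 1)) *\<^sub>q (?E (Suc n) * Kinv\<^sup>2 - ?E (Suc n))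
     + (q powi (- ?n) / (q\<^sup>2 - 1) * qint (?n + 1)) *\<^sub>q
         ((q powi (- 2 * ?n) * q powi (-4)) *\<^sub>q (?E (Suc n) * Kinv\<^sup>2) - ?E (Suc n))"
    unfolding dd F_Echeck
    by (simp add: distrib_left right_diff_distrib scale_mult_left scale_mult_right ee
        U.scale_right_distrib U.scale_right_diff_distrib mult.assoc[where 'a = ratfun] mult.commute mult.left_commute
        add.assoc flip: mult.assoc[where 'a = U])
  also have "\<dots> = (q powi (- 2 * int (Suc n)) * q powi (-2) * qint (?n + 2)) *\<^sub>q (?E (Suc (Suc n)) * F)
     + (q powi (- 2 * int (Suc n)) / (q\<^sup>2 - 1)
         + q powi (- ?n) / (q\<^sup>2 - 1) * qint (?n + 1) * (q powi (- 2 * ?n) * q powi (-4)))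
         *\<^sub>q (?E (Suc n) * Kinv\<^sup>2)
     - (q powi (- 2 * int (Suc n)) / (q\<^sup>2 - 1) + q powi (- ?n) / (q\<^sup>2 - 1) * qint (?n + 1))
         *\<^sub>q ?E (Suc n)"
    by (simp add: U.scale_left_distrib U.scale_right_diff_distrib)
  also have "q powi (- 2 * int (Suc n)) / (q\<^sup>2 - 1)
         + q powi (- ?n) / (q\<^sup>2 - 1) * qint (?n + 1) * (q powi (- 2 * ?n) * q powi (-4))
       = qint (?n + 2) * (q powi (- int (Suc n)) / (q\<^sup>2 - 1) * q powi (- 2 * int (Suc n)))"
    unfolding qint_eq by (rule div)
      (simp add: algebra_simps q_square_mult flip: power_int_add)
  also have "q powi (- 2 * int (Suc n)) / (q\<^sup>2 - 1) + q powi (- ?n) / (q\<^sup>2 - 1) * qint (?n + 1)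
       = qint (?n + 2) * (q powi (- int (Suc n)) / (q\<^sup>2 - 1))"
    unfolding qint_eq by (rule div[where c = 1 and h = 1, unfolded mult_1_right])
      (simp add: algebra_simps q_square_mult flip: power_int_add)
  also have "q powi (- 2 * int (Suc n)) * q powi (-2) = q powi (- 2 * int (Suc (Suc n)))"
    by (simp add: algebra_simps flip: power_int_add)
  finally have "F * ?E (Suc (Suc n)) = inverse (qint (?n + 2)) *\<^sub>q
     ((q powi (- 2 * int (Suc (Suc n))) * qint (?n + 2)) *\<^sub>q (?E (Suc (Suc n)) * F)
     + (qint (?n + 2) * (q powi (- int (Suc n)) / (q\<^sup>2 - 1) * q powi (- 2 * int (Suc n))))
         *\<^sub>q (?E (Suc n) * Kinv\<^sup>2)
     - (qint (?n + 2) * (q powi (- int (Suc n)) / (q\<^sup>2 - 1))) *\<^sub>q ?E (Suc n))" .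
  moreover have "inverse (qint (?n + 2)) * (x * qint (?n + 2)) = x"
      "inverse (qint (?n + 2)) * (qint (?n + 2) * x) = x" for x
    using n2 by simp_all
  ultimately show ?case
    by (simp only: U.scale_right_distrib U.scale_right_diff_distrib right_diff_distrib
        scale_mult_right U.scale_scale mult_1_right add_diff_eq)
qed

section \<open>Layers of normally ordered monomials\<close>

text \<open>
  The layer \<open>L\<^sub>s(P)\<close> is the case \<open>z = 1\<close>, the twisted layer \<open>M\<^sub>s(P)\<close> the case \<open>z = q\<^bsup>-2\<^esup>\<close>. The index is
  an integer because multiplication by \<open>t\<close> also lowers it: with zero for negative index the formulas
  below need no boundary cases.
\<close>

definition layer :: "ratfun \<Rightarrow> int \<Rightarrow> U \<Rightarrow> U" where
  "layer z s P = (\<Sum>a<nat (s + 1). (z ^ a * q powi (- int a * (s - int a))) *\<^sub>q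
     (dpow Echeck a * P * dpow F (nat s - a)))"

lemma layer_neg: "s < 0 \<Longrightarrow> layer z s P = 0"
  by (simp add: layer_def)

lemma layer_add: "layer z s (P + Q) = layer z s P + layer z s Q"
  by (simp add: layer_def distrib_left distrib_right U.scale_right_distrib sum.distrib)

lemma layer_scale: "layer z s (c *\<^sub>q P) = c *\<^sub>q layer z s P"
  by (simp add: layer_def scale_mult_left scale_mult_right U.scale_sum_right mult.commute)

lemma layer_diff: "layer z s (P - Q) = layer z s P - layer z s Q"
  using layer_add[of z s "P - Q" Q] by simp

lemma sum_Suc_shift: "f 0 = 0 \<Longrightarrow> (\<Sum>a<Suc n. f (Suc a)) = (\<Sum>a<Suc (Suc n). f a)"
  for f :: "nat \<Rightarrow> 'a::comm_monoid_add"
  by (simp only: sum.lessThan_Suc_shift[of f "Suc n"]) simp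

text \<open>
  The products with \<open>Echeck\<close> and with \<open>F\<close> are each not yet combinations of layers, because of the
  factors \<open>[a]\<close> and \<open>[n + 1 - a]\<close>; both are summed over the index range of \<open>L\<^bsub>n+1\<^esub>\<close>, so that they can be
  added monomial by monomial.
\<close>

lemma Echeck_layer:
  "Echeck * layer 1 (int n) P = (\<Sum>a<Suc (Suc n).
     (q powi (int (Suc n) - int a) * qint (int a) * q powi (- int a * (int (Suc n) - int a)))
       *\<^sub>q (dpow Echeck a * P * dpow F (Suc n - a)))" (is "_ = sum ?f _")
proof -
  have "Echeck * layer 1 (int n) P = (\<Sum>a<Suc n. q powi (- int a * (int n - int a)) *\<^sub>q
     (Echeck * dpow Echeck a * P * dpow F (n - a)))"
    by (simp add: layer_def sum_distrib_left scale_mult_right nat_add_distrib mult.assoc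
        del: sum.lessThan_Suc)
  also have "\<dots> = (\<Sum>a<Suc n. ?f (Suc a))"
  proof (rule sum.cong)
    fix a
    have "q powi (- int a * (int n - int a)) = q powi (int (Suc n) - int (Suc a))
        * q powi (- int (Suc a) * (int (Suc n) - int (Suc a)))"
      by (simp add: algebra_simps flip: power_int_add)
    then show "q powi (- int a * (int n - int a)) *\<^sub>q
        (Echeck * dpow Echeck a * P * dpow F (n - a)) = ?f (Suc a)"
      by (simp only: mult_dpow scale_mult_left) (simp add: ac_simps)
  qed simp
  also have "\<dots> = sum ?f {..<Suc (Suc n)}"
    by (rule sum_Suc_shift) simp
  finally show ?thesis .
qed

lemma Kinv_layer: "Kinv * layer 1 s P = layer (q powi (-2)) s (Kinv * P)"
  unfolding layer_def sum_distrib_left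
proof (rule sum.cong)
  fix a
  have "Kinv * (dpow Echeck a * P * dpow F (nat s - a)) =
      q powi (- 2 * int a) *\<^sub>q (dpow Echeck a * (Kinv * P) * dpow F (nat s - a))"
    by (metis Kinv_dpow_Echeck mult.assoc scale_mult_left)
  moreover have "(q powi (-2)) ^ a = q powi (- 2 * int a)"
    by (simp only: power_int_mult power_int_of_nat)
  ultimately show "Kinv * ((1 ^ a * q powi (- int a * (s - int a))) *\<^sub>q (dpow Echeck a * P * dpow F (nat s - a)))
    = ((q powi (-2)) ^ a * q powi (- int a * (s - int a))) *\<^sub>q
        (dpow Echeck a * (Kinv * P) * dpow F (nat s - a))"
    by (simp add: scale_mult_right mult.commute)
qed simp

lemma F_layer:
  assumes "F * P = P' * F"
  shows "F * layer 1 (int n) P =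
     (\<Sum>a<Suc (Suc n). (q powi (- int a) * qint (int (Suc n) - int a) *
          q powi (- int a * (int (Suc n) - int a))) *\<^sub>q
        (dpow Echeck a * P' * dpow F (Suc n - a)))
     + (q powi (1 - int n) / (q\<^sup>2 - 1)) *\<^sub>q
         (layer (q powi (-2)) (int n - 1) (Kinv\<^sup>2 * P) - layer 1 (int n - 1) P)"
    (is "_ = sum ?u _ + ?r")
proof -
  \<comment> \<open>\<open>?v a\<close> is the part of \<open>F * dpow Echeck a\<close> in which \<open>F\<close> has been absorbed into \<open>h\<close>.\<close>
  let ?c = "\<lambda>a. q powi (- int a * (int n - int a))"
  let ?v = "\<lambda>a. case a of 0 \<Rightarrow> 0 | Suc b \<Rightarrow> (q powi (- int b) / (q\<^sup>2 - 1)) *\<^sub>q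
     (dpow Echeck b * (q powi (- 2 * int b) *\<^sub>q Kinv\<^sup>2 - 1))"
  have F_dpow: "F * dpow Echeck a = q powi (- 2 * int a) *\<^sub>q (dpow Echeck a * F) + ?v a" for a
    by (cases a) (simp_all only: F_dpow_Echeck_Suc nat.case, simp)
  have split: "?c a *\<^sub>q (F * dpow Echeck a * P * dpow F (n - a))
      = ?u a + ?c a *\<^sub>q (?v a * P * dpow F (n - a))" if "a < Suc n" for a
  proof -
    have "dpow Echeck a * F * P * dpow F (n - a)
        = qint (int (Suc n) - int a) *\<^sub>q (dpow Echeck a * P' * dpow F (Suc n - a))"
    proof -
      have "dpow Echeck a * F * P * dpow F (n - a) = dpow Echeck a * P' * (F * dpow F (n - a))"
        by (metis assms mult.assoc)
      with that show ?thesis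
        by (simp add: mult_dpow scale_mult_right Suc_diff_le of_nat_diff algebra_simps)
    qed
    moreover have "?c a * q powi (- 2 * int a) =
        q powi (- int a) * q powi (- int a * (int (Suc n) - int a))"
      by (simp add: algebra_simps flip: power_int_add)
    ultimately show ?thesis
      unfolding F_dpow by (simp add: distrib_right scale_mult_left U.scale_right_distrib ac_simps)
  qed
  have "F * layer 1 (int n) P = (\<Sum>a<Suc n. ?c a *\<^sub>q (F * dpow Echeck a * P * dpow F (n - a)))"
    by (simp add: layer_def sum_distrib_left scale_mult_right nat_add_distrib mult.assoc
        del: sum.lessThan_Suc)
  also have "\<dots> = sum ?u {..<Suc n} + (\<Sum>a<Suc n. ?c a *\<^sub>q (?v a * P * dpow F (n - a)))"
    unfolding sum.distrib[symmetric] by (intro sum.cong refl split) simp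
  also have "sum ?u {..<Suc n} = sum ?u {..<Suc (Suc n)}"
    by simp
  also have "(\<Sum>a<Suc n. ?c a *\<^sub>q (?v a * P * dpow F (n - a))) =
      (\<Sum>a<n. ?c (Suc a) *\<^sub>q (?v (Suc a) * P * dpow F (n - Suc a)))"
    by (subst sum.lessThan_Suc_shift) simp
  also have "\<dots> = ?r"
  proof (cases n)
    case 0
    then show ?thesis by (simp add: layer_neg)
  next
    case (Suc k)
    let ?d = "q powi (1 - int n) / (q\<^sup>2 - 1)"
    have "?c (Suc b) *\<^sub>q (?v (Suc b) * P * dpow F (n - Suc b)) =
       ?d *\<^sub>q ((((q powi (-2)) ^ b * q powi (- int b * (int k - int b))) *\<^sub>q
           (dpow Echeck b * (Kinv\<^sup>2 * P) * dpow F (k - b)))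
         - (1 ^ b * q powi (- int b * (int k - int b))) *\<^sub>q (dpow Echeck b * P * dpow F (k - b)))" for b
    proof -
      \<comment> \<open>The exponents agree as \<open>-(b+1)(k-b) - b = -b(k-b) - k\<close>: what depends on \<open>b\<close> is the weight
        of \<open>L\<^sub>k\<close>.\<close>
      have "?c (Suc b) * (q powi (- int b) / (q\<^sup>2 - 1)) = ?d * q powi (- int b * (int k - int b))"
        using Suc by (simp add: algebra_simps flip: power_int_add)
      moreover have "(q powi (-2)) ^ b = q powi (- 2 * int b)"
        by (simp only: power_int_mult power_int_of_nat)
      ultimately show ?thesis
        using Suc by (simp add: right_diff_distrib left_diff_distrib scale_mult_left scale_mult_right
          U.scale_right_diff_distrib mult.assoc mult.commute[of "q powi (- (2 * int b))"]
          del: times_divide_eq_right times_divide_eq_left)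
    qed
    then show ?thesis
      using Suc by (simp add: layer_def nat_add_distrib sum_subtractf U.scale_sum_right
         U.scale_right_diff_distrib del: sum.lessThan_Suc)
  qed
  finally show ?thesis .
qed

text \<open>
  In \<open>t L\<^sub>s(P)\<close> the weighted coefficients at index \<open>s + 1\<close> are \<open>q\<^bsup>s+1-a\<^esup>[a]\<close> with \<open>P\<close> and
  \<open>q\<^bsup>-a\<^esup>[s+1-a]\<close> with \<open>P'\<close>. Over the denominator \<open>q - q\<^bsup>-1\<^esup>\<close> these are \<open>q\<^bsup>s+1\<^esup> - q\<^bsup>s+1-2a\<^esup>\<close> and
  \<open>q\<^bsup>s+1-2a\<^esup> - q\<^bsup>-s-1\<^esup>\<close>, so that the twisted part depends on \<open>P - P'\<close> only.
\<close>

lemma t_layer: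
  assumes "F * P = P' * F"
  shows "t * layer 1 s P =
     (1 / (q\<^sup>2 - 1)) *\<^sub>q (q powi (s + 2) *\<^sub>q layer 1 (s + 1) P
        - q powi (- s) *\<^sub>q layer 1 (s + 1) P'
        - q powi (s + 2) *\<^sub>q layer (q powi (-2)) (s + 1) (P - P'))
     + layer (q powi (-2)) s (Kinv * P)
     + (q powi (1 - s) / (q\<^sup>2 - 1)) *\<^sub>q
         (layer (q powi (-2)) (s - 1) (Kinv\<^sup>2 * P) - layer 1 (s - 1) P)"
proof -
  consider "s < -1" | "s = -1" | n where "s = int n"
  proof -
    have "s < -1 \<or> s = -1 \<or> s \<ge> 0"
      by linarith
    with that show ?thesis
      using nonneg_int_cases[of s] by blast
  qed
  then show ?thesis
  proof cases
    case 1
    then show ?thesis by (simp add: layer_neg)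
  next
    case 2
    \<comment> \<open>The left side is zero, and on the right \<open>L\<^sub>0(P) - L\<^sub>0(P') - M\<^sub>0(P - P') = 0\<close>.\<close>
    have "layer z 0 R = R" for z R
      by (simp add: layer_def)
    with 2 show ?thesis by (simp add: layer_neg U.scale_right_diff_distrib)
  next
    case (3 n)
    let ?k = "1 / (q\<^sup>2 - 1)"
    let ?c = "\<lambda>a. q powi (- int a * (int (Suc n) - int a))"
    let ?w = "\<lambda>a R. dpow Echeck a * R * dpow F (Suc n - a)"
    have lay: "layer z (int n + 1) R = (\<Sum>a<Suc (Suc n). (z ^ a * ?c a) *\<^sub>q ?w a R)" for z R
      by (simp add: layer_def nat_add_distrib add.commute del: sum.lessThan_Suc)
    have "(q powi (int (Suc n) - int a) * qint (int a) * ?c a) *\<^sub>q ?w a P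
        + (q powi (- int a) * qint (int (Suc n) - int a) * ?c a) *\<^sub>q ?w a P'
      = ?k *\<^sub>q (q powi (s + 2) *\<^sub>q ((1 ^ a * ?c a) *\<^sub>q ?w a P)
        - q powi (- s) *\<^sub>q ((1 ^ a * ?c a) *\<^sub>q ?w a P')
        - q powi (s + 2) *\<^sub>q (((q powi (-2)) ^ a * ?c a) *\<^sub>q ?w a (P - P')))" for a
    proof -
      have e: "(q powi (-2)) ^ a = q powi (- 2 * int a)"
        by (simp only: power_int_mult power_int_of_nat)
      have q1: "q powi (int (Suc n) - int a) * qint (int a)
          = ?k * (q powi (s + 2) - q powi (s + 2) * q powi (- 2 * int a))"
        unfolding qint_eq 3 by (simp add: algebra_simps diff_divide_distrib flip: power_int_add)
      have q2: "q powi (- int a) * qint (int (Suc n) - int a)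
          = ?k * (q powi (s + 2) * q powi (- 2 * int a) - q powi (- s))"
        unfolding qint_eq 3 by (simp add: algebra_simps diff_divide_distrib flip: power_int_add)
      show ?thesis
        unfolding e q1 q2
        by (simp add: right_diff_distrib left_diff_distrib U.scale_right_diff_distrib
            U.scale_left_diff_distrib ac_simps del: times_divide_eq_right times_divide_eq_left)
    qed
    then have "Echeck * layer 1 (int n) P + (\<Sum>a<Suc (Suc n). (q powi (- int a) *
          qint (int (Suc n) - int a) * q powi (- int a * (int (Suc n) - int a))) *\<^sub>q
          (dpow Echeck a * P' * dpow F (Suc n - a)))
      = ?k *\<^sub>q (q powi (s + 2) *\<^sub>q layer 1 (s + 1) P
        - q powi (- s) *\<^sub>q layer 1 (s + 1) P'
        - q powi (s + 2) *\<^sub>q layer (q powi (-2)) (s + 1) (P - P'))"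
      unfolding Echeck_layer 3 lay
      by (simp only: U.scale_sum_right flip: sum.distrib sum_subtractf)
    then show ?thesis
      unfolding t_def distrib_right 3 Kinv_layer F_layer[OF assms] by (simp add: algebra_simps)
  qed
qed

section \<open>The binomials in h\<close>

lemma F_Kinv_square: "F * Kinv\<^sup>2 = q powi (-4) *\<^sub>q (Kinv\<^sup>2 * F)"
proof -
  have "F * Kinv\<^sup>2 = (q powi (-2) * q powi (-2)) *\<^sub>q (Kinv\<^sup>2 * F)"
    by (simp add: power2_eq_square F_Kinv scale_mult_left flip: mult.assoc)
      (simp add: F_Kinv scale_mult_right mult.assoc)
  also have "q powi (-2) * q powi (-2) = q powi (-4)"
    by (simp flip: power_int_add)
  finally show ?thesis .
qed

definition hfactor :: "int \<Rightarrow> U" where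
  "hfactor e = q powi e *\<^sub>q Kinv\<^sup>2 - 1"

lemma Kinv_hfactor: "Kinv * hfactor e = hfactor e * Kinv"
  by (simp add: hfactor_def left_diff_distrib right_diff_distrib scale_mult_left scale_mult_right
      power_commutes)

lemma hfactor_commute: "hfactor d * hfactor e = hfactor e * hfactor d"
  by (simp add: hfactor_def algebra_simps scale_mult_left scale_mult_right)

lemma F_hfactor: "F * hfactor e = hfactor (e - 4) * F"
  by (simp add: hfactor_def left_diff_distrib right_diff_distrib scale_mult_left scale_mult_right
      F_Kinv_square flip: power_int_add)

lemma hbinom_0 [simp]: "hbinom a 0 = 1"
  by (simp add: hbinom_def)

lemma hbinom_Suc:
  "hbinom a (Suc c) = inverse (q ^ (4 * Suc c) - 1) *\<^sub>q (hbinom a c * hfactor (4 * a + 4 * int c))"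
  by (simp add: hbinom_def hfactor_def scale_mult_right algebra_simps)

lemma Kinv_hbinom: "Kinv * hbinom a c = hbinom a c * Kinv"
proof (induction c)
  case (Suc c)
  then show ?case
    by (simp only: hbinom_Suc scale_mult_left scale_mult_right mult.assoc flip: Kinv_hfactor)
      (simp only: flip: mult.assoc)
qed simp

lemma F_hbinom: "F * hbinom a c = hbinom (a - 1) c * F"
proof (induction c)
  case (Suc c)
  have "4 * (a - 1) + 4 * int c = 4 * a + 4 * int c - 4"
    by simp
  with Suc show ?case
    by (simp only: hbinom_Suc scale_mult_left scale_mult_right mult.assoc flip: F_hfactor)
      (simp only: flip: mult.assoc)
qed simp

text \<open>
  Up to scalars, the factors of \<open>hbinom (a - 1) (Suc c)\<close> are those of \<open>hbinom a c\<close> and one more at the beginning, whereas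
  \<open>hbinom a (Suc c)\<close> has its additional factor at the end.
\<close>

lemma hbinom_pred_Suc:
  "hbinom (a - 1) (Suc c) = inverse (q ^ (4 * Suc c) - 1) *\<^sub>q (hbinom a c * hfactor (4 * a - 4))"
proof (induction c)
  case 0
  show ?case by (simp add: hbinom_Suc)
next
  case (Suc c)
  have "4 * (a - 1) + 4 * int (Suc c) = 4 * a + 4 * int c"
    by simp
  then show ?case
    by (simp only: hbinom_Suc[of _ "Suc c"] Suc.IH hbinom_Suc[of a c] scale_mult_left scale_mult_right
        mult.assoc hfactor_commute[of "4 * a - 4"])
qed

lemma hbinom_diff:
  "hbinom a (Suc c) - e *\<^sub>q hbinom (a - 1) (Suc c) = inverse (q ^ (4 * Suc c) - 1) *\<^sub>q
     (hbinom a c * (hfactor (4 * a + 4 * int c) - e *\<^sub>q hfactor (4 * a - 4)))"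
  unfolding hbinom_pred_Suc unfolding hbinom_Suc
  by (simp add: right_diff_distrib scale_mult_right U.scale_right_diff_distrib mult.commute
      del: mult_Suc_right)

text \<open>
  As \<open>hbinom a (Suc c)\<close> and \<open>hbinom (a - 1) (Suc c)\<close> are \<open>hbinom a c\<close> times linear polynomials in
  \<open>K\<^sup>-\<^sup>2\<close>, they span the products of \<open>hbinom a c\<close> with \<open>1\<close> and with \<open>K\<^sup>-\<^sup>2\<close>. The next two lemmas give
  the coefficients.
\<close>

lemma hbinom_pascal:
  "hbinom a c = hbinom a (Suc c) - q powi (4 * int (Suc c)) *\<^sub>q hbinom (a - 1) (Suc c)"
proof -
  let ?e = "q powi (4 * int (Suc c))"
  have nz: "q ^ (4 * Suc c) - 1 \<noteq> 0"
    using q_power_neq_1[of "4 * Suc c"] by simp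
  have "?e = q ^ (4 * Suc c)"
    by (metis of_nat_mult of_nat_numeral power_int_of_nat)
  moreover have "?e *\<^sub>q hfactor (4 * a - 4)
      = q powi (4 * a + 4 * int c) *\<^sub>q Kinv\<^sup>2 - ?e *\<^sub>q 1"
    unfolding hfactor_def by (simp add: U.scale_right_diff_distrib algebra_simps flip: power_int_add)
  ultimately have "hfactor (4 * a + 4 * int c) - ?e *\<^sub>q hfactor (4 * a - 4)
      = (q ^ (4 * Suc c) - 1) *\<^sub>q 1"
    by (simp add: hfactor_def U.scale_left_diff_distrib del: mult_Suc_right)
  with nz show ?thesis
    unfolding hbinom_diff by (simp add: scale_mult_right del: mult_Suc_right)
qed

lemma Kinv_square_hbinom:
  "Kinv\<^sup>2 * hbinom a c = q powi (4 - 4 * a) *\<^sub>q (hbinom a (Suc c) - hbinom (a - 1) (Suc c))"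
proof -
  have nz: "q ^ (4 * Suc c) - 1 \<noteq> 0"
    using q_power_neq_1[of "4 * Suc c"] by simp
  have "q powi (4 * a + 4 * int c) = q powi (4 * a - 4) * q ^ (4 * Suc c)"
  proof -
    have "q powi (4 * a + 4 * int c) = q powi (4 * a - 4) * q powi (4 * int (Suc c))"
      by (simp add: algebra_simps flip: power_int_add)
    also have "q powi (4 * int (Suc c)) = q ^ (4 * Suc c)"
      by (metis of_nat_mult of_nat_numeral power_int_of_nat)
    finally show ?thesis .
  qed
  then have "hfactor (4 * a + 4 * int c) - hfactor (4 * a - 4)
      = (q powi (4 * a - 4) * (q ^ (4 * Suc c) - 1)) *\<^sub>q Kinv\<^sup>2"
    by (simp add: hfactor_def U.scale_left_diff_distrib right_diff_distrib del: mult_Suc_right)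
  then have "hbinom a (Suc c) - hbinom (a - 1) (Suc c) = q powi (4 * a - 4) *\<^sub>q (hbinom a c * Kinv\<^sup>2)"
    using hbinom_diff[of a c 1] nz by (simp add: scale_mult_right del: mult_Suc_right)
  also have "hbinom a c * Kinv\<^sup>2 = Kinv\<^sup>2 * hbinom a c"
    by (metis Kinv_hbinom mult.assoc power2_eq_square)
  finally show ?thesis
    by (simp flip: power_int_add)
qed

section \<open>Multiplying the layers of binomials by t\<close>

text \<open>
  These are the layers \<open>M\<^sub>s(K\<^sup>-\<^sup>2 y H\<^sub>c\<^sub>-\<^sub>1)\<close> and \<open>L\<^sub>s(y H\<^sub>c\<^sub>-\<^sub>1)\<close>, with \<open>H\<^sub>c = hbinom a c\<close> and \<open>y\<close> a power
  of \<open>K\<inverse>\<close>, rewritten by the two Pascal relations in terms of \<open>H\<^sub>c\<close> and \<open>hbinom (a - 1) c\<close>. In this form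
  they make sense, and vanish, for \<open>c = 0\<close>: this is the convention \<open>H\<^bsub>-1\<^esub> = 0\<close>.
\<close>

definition prev_twisted :: "int \<Rightarrow> int \<Rightarrow> nat \<Rightarrow> U \<Rightarrow> U" where
  "prev_twisted s a c y = q powi (4 - 4 * a) *\<^sub>q
     (layer (q powi (-2)) s (y * hbinom a c) - layer (q powi (-2)) s (y * hbinom (a - 1) c))"

definition prev_layer :: "int \<Rightarrow> int \<Rightarrow> nat \<Rightarrow> U \<Rightarrow> U" where
  "prev_layer s a c y = layer 1 s (y * hbinom a c) - q powi (4 * int c) *\<^sub>q layer 1 s (y * hbinom (a - 1) c)"

lemma prev_0 [simp]: "prev_twisted s a 0 y = 0" "prev_layer s a 0 y = 0"
  by (simp_all add: prev_twisted_def prev_layer_def)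

lemma prev_neg: "s < 0 \<Longrightarrow> prev_twisted s a c y = 0" "s < 0 \<Longrightarrow> prev_layer s a c y = 0"
  by (simp_all add: prev_twisted_def prev_layer_def layer_neg)

lemma layer_eq_prev_layer: "layer 1 s (y * hbinom a c) = prev_layer s a (Suc c) y"
  by (simp only: hbinom_pascal[of a c] prev_layer_def right_diff_distrib scale_mult_right layer_diff layer_scale)

lemma twisted_eq_prev_twisted: "layer (q powi (-2)) s (y * (Kinv\<^sup>2 * hbinom a c)) = prev_twisted s a (Suc c) y"
  by (simp add: Kinv_square_hbinom prev_twisted_def layer_diff layer_scale right_diff_distrib scale_mult_right)

text \<open>
  The part of \<open>t L\<^bsub>s-1\<^esub>(y H\<^sub>c)\<close> of index \<open>s\<close>, multiplied by \<open>q\<^sup>2 - 1\<close>, where \<open>F y = f y F\<close>.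
\<close>

definition raised :: "int \<Rightarrow> int \<Rightarrow> nat \<Rightarrow> U \<Rightarrow> ratfun \<Rightarrow> U" where
  "raised s a c y f = q powi (s + 1) *\<^sub>q layer 1 s (y * hbinom a c)
     - (q powi (1 - s) * f) *\<^sub>q layer 1 s (y * hbinom (a - 1) c)
     - q powi (s + 1) *\<^sub>q (layer (q powi (-2)) s (y * hbinom a c)
         - f *\<^sub>q layer (q powi (-2)) s (y * hbinom (a - 1) c))"

text \<open>
  The part that lowers the index is expressed by binomials of index \<open>c + 1\<close>. This is the form in which
  it meets the part that raises the index of the layer belonging to \<open>c + 1\<close>, as going from \<open>c\<close> to
  \<open>c + 1\<close> lowers \<open>s\<close> by two.
\<close>

lemma t_layer_hbinom:
  assumes F: "F * y = f *\<^sub>q (y * F)" and Kinv: "Kinv * y = y * Kinv"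
  shows "t * layer 1 s (y * hbinom a c) =
    (1 / (q\<^sup>2 - 1)) *\<^sub>q raised (s + 1) a c y f
    + layer (q powi (-2)) s (Kinv * (y * hbinom a c))
    + (q powi (1 - s) / (q\<^sup>2 - 1)) *\<^sub>q (prev_twisted (s - 1) a (Suc c) y - prev_layer (s - 1) a (Suc c) y)"
proof -
  have "F * (y * hbinom a c) = (f *\<^sub>q (y * hbinom (a - 1) c)) * F"
    by (metis F F_hbinom mult.assoc scale_mult_left)
  moreover have "Kinv\<^sup>2 * (y * hbinom a c) = y * (Kinv\<^sup>2 * hbinom a c)"
    by (metis Kinv mult.assoc power2_eq_square)
  ultimately show ?thesis
    by (simp add: t_layer raised_def twisted_eq_prev_twisted layer_diff layer_scale add.commute flip: layer_eq_prev_layer)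
qed

section \<open>The recurrences for the sums of layers\<close>

definition even_term :: "nat \<Rightarrow> nat \<Rightarrow> U" where
  "even_term m c =
     q powi (int c * (2 * int c + 1)) *\<^sub>q layer 1 (2 * int m - 2 * int c) (hbinom (1 - int m) c)
   + q powi ((int c + 1) * (2 * int c + 1) - 2 * int m) *\<^sub>q
       layer 1 (2 * int m - 1 - 2 * int c) (Kinv * hbinom (1 - int m) c)"

definition odd_term :: "nat \<Rightarrow> nat \<Rightarrow> U" where
  "odd_term m c =
     q powi (int c * (2 * int c - 1)) *\<^sub>q layer 1 (2 * int m + 1 - 2 * int c) (hbinom (1 - int m) c)
   + q powi (int c * (2 * int c + 1) - 2 * int m) *\<^sub>q
       layer 1 (2 * int m - 2 * int c) (Kinv * hbinom (1 - int m) c)"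

text \<open>
  The linear algebra of one index: \<open>h\<close>, \<open>h'\<close> stand for the layers of \<open>H\<^sub>c\<close> and \<open>H'\<^sub>c\<close>, and \<open>g\<close>, \<open>g'\<close> for
  the twisted ones. The hypotheses say that the coefficients of \<open>g\<close> and of \<open>g'\<close> vanish.
\<close>

lemma combine_layers:
  assumes "k1 * a3 = b + k2 * d" and "k1 * a3 * f = b' + k2 * d"
  shows "k1 *\<^sub>q (a1 *\<^sub>q h - a2 *\<^sub>q h' - a3 *\<^sub>q (g - f *\<^sub>q g')) + (b *\<^sub>q g - b' *\<^sub>q g')
      + k2 *\<^sub>q (d *\<^sub>q (g - g') - (h - e *\<^sub>q h')) - r *\<^sub>q (h - e *\<^sub>q h')
    = (k1 * a1 - k2 - r) *\<^sub>q h + ((k2 + r) * e - k1 * a2) *\<^sub>q h'"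
proof -
  have "k1 *\<^sub>q (a1 *\<^sub>q h - a2 *\<^sub>q h' - a3 *\<^sub>q (g - f *\<^sub>q g'))
     = (k1 * a1) *\<^sub>q h - (k1 * a2) *\<^sub>q h' - ((k1 * a3) *\<^sub>q g - (k1 * a3 * f) *\<^sub>q g')"
    by (simp add: U.scale_right_diff_distrib mult.assoc)
  then show ?thesis
    unfolding assms(2) unfolding assms(1) by (simp add: U.scale_right_diff_distrib U.scale_left_diff_distrib
        U.scale_left_distrib distrib_right)
qed

text \<open>
  The three contributions of index \<open>s\<close> to \<open>t\<close> times a sum of layers: the raised layer, the twisted layer
  that comes from multiplication by \<open>K\<inverse>\<close>, and the lowered one. The last summand, with coefficient \<open>r\<close>,
  is for the recurrence that subtracts a multiple of an earlier divided power.
\<close>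

lemma match_layers:
  assumes "k * q powi (s + 1) = b + k' * q powi (4 - 4 * a)"
    and "k * q powi (s + 1) * f = b' + k' * q powi (4 - 4 * a)"
  shows "k *\<^sub>q raised s a c y f
      + (b *\<^sub>q layer (q powi (-2)) s (y * hbinom a c) - b' *\<^sub>q layer (q powi (-2)) s (y * hbinom (a - 1) c))
      + k' *\<^sub>q (prev_twisted s a c y - prev_layer s a c y) - r *\<^sub>q prev_layer s a c y
    = (k * q powi (s + 1) - k' - r) *\<^sub>q layer 1 s (y * hbinom a c)
      + ((k' + r) * q powi (4 * int c) - k * (q powi (1 - s) * f)) *\<^sub>q layer 1 s (y * hbinom (a - 1) c)"
  unfolding raised_def prev_twisted_def prev_layer_def by (rule combine_layers[OF assms])

lemma sum_shift_index:
  fixes A B :: "nat \<Rightarrow> 'a::comm_monoid_add"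
  assumes "B 0 = 0" and "B (Suc M) = 0"
  shows "(\<Sum>c\<le>M. A c + B (Suc c)) = (\<Sum>c\<le>M. A c + B c)"
proof -
  have "(\<Sum>c\<le>M. B (Suc c)) = (\<Sum>c\<le>M. B c)"
    using assms sum.atMost_Suc_shift[of B M] sum.atMost_Suc[of B M] by simp
  then show ?thesis
    by (simp add: sum.distrib)
qed

text \<open>
  In the proof, \<open>A c\<close> is the part of \<open>t\<close> times the term of \<open>c\<close> that is expressed by binomials of index
  \<open>c\<close>, and \<open>B (Suc c)\<close> is the part expressed by those of index \<open>c + 1\<close>. Since \<open>B\<close> vanishes at both
  ends, the shift can be undone in the sum, and then the claim holds for each \<open>c\<close>, separately for the layers
  with and without \<open>K\<inverse>\<close>.
\<close>

lemma t_even_sum: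
  "t * (\<Sum>c\<le>m. even_term m c) = qint (2 * int m + 1) *\<^sub>q (\<Sum>c\<le>m. odd_term m c)"
proof -
  define a where "a = 1 - int m"
  let ?H = "hbinom a" and ?H' = "hbinom (a - 1)"
  let ?L = "layer 1" and ?M = "layer (q powi (-2))" and ?d = "q\<^sup>2 - 1"
  let ?s = "\<lambda>c. 2 * int m - 2 * int c"
  define u where "u c = q powi (int c * (2 * int c + 1))" for c
  define v where "v c = q powi ((int c + 1) * (2 * int c + 1) - 2 * int m)" for c
  define b where "b c = q powi (2 * int c * int c - int c - 2 * int m)" for c
  define k where "k c = b c / ?d" for c
  define k' where "k' c = q powi (2 * int c * int c + int c - 4 * int m) / ?d" for c
  define A where "A c = (u c / ?d) *\<^sub>q raised (?s c + 1) a c 1 1 + u c *\<^sub>q ?M (?s c) (Kinv * ?H c)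
     + (v c / ?d) *\<^sub>q raised (?s c) a c Kinv (q powi (-2))" for c
  define B where "B c = b c *\<^sub>q prev_twisted (?s c + 1) a c 1
     + k c *\<^sub>q (prev_twisted (?s c + 1) a c 1 - prev_layer (?s c + 1) a c 1)
     + k' c *\<^sub>q (prev_twisted (?s c) a c Kinv - prev_layer (?s c) a c Kinv)" for c
  have step: "t * even_term m c = A c + B (Suc c)" for c
  proof -
    have 1: "t * layer 1 (?s c) (?H c) = (1 / ?d) *\<^sub>q raised (?s c + 1) a c 1 1 + ?M (?s c) (Kinv * ?H c)
      + (q powi (1 - ?s c) / ?d) *\<^sub>q (prev_twisted (?s c - 1) a (Suc c) 1 - prev_layer (?s c - 1) a (Suc c) 1)"
      using t_layer_hbinom[of 1 1 "?s c" a c] by simp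
    have 2: "t * layer 1 (?s c - 1) (Kinv * ?H c) = (1 / ?d) *\<^sub>q raised (?s c) a c Kinv (q powi (-2))
      + prev_twisted (?s c - 1) a (Suc c) 1
      + (q powi (1 - (?s c - 1)) / ?d) *\<^sub>q
          (prev_twisted (?s c - 1 - 1) a (Suc c) Kinv - prev_layer (?s c - 1 - 1) a (Suc c) Kinv)"
      using t_layer_hbinom[OF F_Kinv refl, of "?s c - 1" a c] twisted_eq_prev_twisted[of "?s c - 1" 1 a c]
      by (simp only: diff_add_cancel power2_eq_square mult.assoc mult_1_left)
    have e: "u c * (q powi (1 - ?s c) / ?d) = k (Suc c)" "v c = b (Suc c)"
      "v c * (q powi (1 - (?s c - 1)) / ?d) = k' (Suc c)"
      by (simp_all add: u_def v_def k_def k'_def b_def algebra_simps flip: power_int_add)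
    have s: "2 * int m - 1 - 2 * int c = ?s c - 1"
      and s': "?s c - 1 = ?s (Suc c) + 1" "?s (Suc c) + 1 - 1 = ?s (Suc c)"
      by simp_all
    have "t * even_term m c
      = u c *\<^sub>q ((1 / ?d) *\<^sub>q raised (?s c + 1) a c 1 1 + ?M (?s c) (Kinv * ?H c)
      + (q powi (1 - ?s c) / ?d) *\<^sub>q (prev_twisted (?s c - 1) a (Suc c) 1 - prev_layer (?s c - 1) a (Suc c) 1))
      + v c *\<^sub>q ((1 / ?d) *\<^sub>q raised (?s c) a c Kinv (q powi (-2))
      + prev_twisted (?s c - 1) a (Suc c) 1
      + (q powi (1 - (?s c - 1)) / ?d) *\<^sub>q
          (prev_twisted (?s c - 1 - 1) a (Suc c) Kinv - prev_layer (?s c - 1 - 1) a (Suc c) Kinv))"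
      unfolding even_term_def distrib_left[where 'a = U] scale_mult_right a_def[symmetric] s 1 2
      by (simp only: u_def v_def U.scale_right_distrib)
    also have "\<dots> = A c + B (Suc c)"
      unfolding A_def B_def U.scale_right_distrib U.scale_scale e(1,3) unfolding e(2)[symmetric] s'
      by (simp add: ac_simps)
    finally show ?thesis .
  qed
  have match: "A c + B c = qint (2 * int m + 1) *\<^sub>q odd_term m c" for c
  proof -
    have s: "2 * int m + 1 - 2 * int c = ?s c + 1"
      by simp
    \<comment> \<open>Here \<open>k\<close> cancels the twisted layers, and \<open>h\<close>, \<open>h'\<close> are the coefficients of the layers of
      \<open>?H c\<close> and \<open>?H' c\<close>.\<close>
    have 1: "(u c / ?d) *\<^sub>q raised (?s c + 1) a c 1 1 + b c *\<^sub>q prev_twisted (?s c + 1) a c 1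
       + k c *\<^sub>q (prev_twisted (?s c + 1) a c 1 - prev_layer (?s c + 1) a c 1)
       = (qint (2 * int m + 1) * q powi (int c * (2 * int c - 1))) *\<^sub>q ?L (?s c + 1) (?H c)"
    proof -
      have k: "u c / ?d * q powi (?s c + 1 + 1) = b c * q powi (4 - 4 * a) + k c * q powi (4 - 4 * a)"
        using q_square_neq_1 unfolding k_def u_def b_def a_def
        by (simp add: divide_simps) (simp add: algebra_simps q_square_mult flip: power_int_add)
      have h: "u c / ?d * q powi (?s c + 1 + 1) - k c - 0 = qint (2 * int m + 1) * q powi (int c * (2 * int c - 1))"
        using q_square_neq_1 unfolding k_def u_def b_def a_def qint_eq
        by (simp add: divide_simps) (simp add: algebra_simps q_square_mult flip: power_int_add)
      have h': "(k c + 0) * q powi (4 * int c) - u c / ?d * (q powi (1 - (?s c + 1)) * 1) = 0"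
        using q_square_neq_1 unfolding k_def u_def b_def a_def
        by (simp add: divide_simps) (simp add: algebra_simps q_square_mult flip: power_int_add)
      show ?thesis
        using match_layers[of "u c / ?d" "?s c + 1" "b c * q powi (4 - 4 * a)" "k c" a 1
            "b c * q powi (4 - 4 * a)" c 1 0] k
        unfolding h h' by (simp add: prev_twisted_def U.scale_right_diff_distrib)
    qed
    have 2: "(v c / ?d) *\<^sub>q raised (?s c) a c Kinv (q powi (-2)) + u c *\<^sub>q ?M (?s c) (Kinv * ?H c)
       + k' c *\<^sub>q (prev_twisted (?s c) a c Kinv - prev_layer (?s c) a c Kinv)
       = (qint (2 * int m + 1) * q powi (int c * (2 * int c + 1) - 2 * int m)) *\<^sub>q ?L (?s c) (Kinv * ?H c)"
    proof -
      have k: "v c / ?d * q powi (?s c + 1) = u c + k' c * q powi (4 - 4 * a)"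
        "v c / ?d * q powi (?s c + 1) * q powi (-2) = 0 + k' c * q powi (4 - 4 * a)"
        using q_square_neq_1 unfolding k'_def u_def v_def a_def
        by (simp_all add: divide_simps) (simp_all add: algebra_simps q_square_mult flip: power_int_add)
      have h: "v c / ?d * q powi (?s c + 1) - k' c - 0
          = qint (2 * int m + 1) * q powi (int c * (2 * int c + 1) - 2 * int m)"
        using q_square_neq_1 unfolding k'_def u_def v_def a_def qint_eq
        by (simp add: divide_simps) (simp add: algebra_simps q_square_mult flip: power_int_add)
      have h': "(k' c + 0) * q powi (4 * int c) - v c / ?d * (q powi (1 - ?s c) * q powi (-2)) = 0"
        using q_square_neq_1 unfolding k'_def u_def v_def a_def
        by (simp add: divide_simps) (simp add: algebra_simps q_square_mult flip: power_int_add)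
      show ?thesis
        using match_layers[OF k, of c Kinv 0]
        unfolding h h' by simp
    qed
    show ?thesis
      unfolding odd_term_def s a_def[symmetric] U.scale_right_distrib U.scale_scale 1[symmetric] 2[symmetric]
      by (simp only: A_def B_def add_ac)
  qed
  have "t * (\<Sum>c\<le>m. even_term m c) = (\<Sum>c\<le>m. A c + B (Suc c))"
    by (simp only: sum_distrib_left step)
  also have "\<dots> = (\<Sum>c\<le>m. A c + B c)"
    by (rule sum_shift_index) (simp_all add: B_def prev_neg)
  also have "\<dots> = qint (2 * int m + 1) *\<^sub>q (\<Sum>c\<le>m. odd_term m c)"
    by (simp only: match U.scale_sum_right)
  finally show ?thesis .
qed

lemma terms_vanish: "even_term m (Suc m) = 0" "odd_term m (Suc m) = 0"
  by (simp_all add: even_term_def odd_term_def layer_neg)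

text \<open>
  The same computation, except that the surviving layers are now those of \<open>H'\<^sub>c\<close>, which is the binomial
  \<open>hbinom (1 - Suc m) c\<close> of the next even step. Cancelling \<open>H\<^sub>c\<close> needs the subtracted multiple of the even sum,
  whose layers \<open>L\<^sub>s(H\<^sub>c)\<close> also count as layers of binomials of index \<open>c + 1\<close>.
\<close>

lemma t_odd_sum:
  "t * (\<Sum>c\<le>m. odd_term m c) = qint (2 * int m + 2) *\<^sub>q (\<Sum>c\<le>Suc m. even_term (Suc m) c)
     + qint (2 * int m + 1) *\<^sub>q (\<Sum>c\<le>m. even_term m c)"
proof -
  define a where "a = 1 - int m"
  have a': "1 - int (Suc m) = a - 1"
    by (simp add: a_def)
  let ?H = "hbinom a" and ?H' = "hbinom (a - 1)"
  let ?L = "layer 1" and ?M = "layer (q powi (-2))" and ?d = "q\<^sup>2 - 1"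
  let ?s = "\<lambda>c. 2 * int m - 2 * int c" and ?N = "qint (2 * int m + 1)"
  define u where "u c = q powi (int c * (2 * int c - 1))" for c
  define v where "v c = q powi (int c * (2 * int c + 1) - 2 * int m)" for c
  define b where "b c = q powi ((int c - 1) * (2 * int c - 1) - 2 * int m)" for c
  define k where "k c = b c / ?d" for c
  define k' where "k' c = q powi (int c * (2 * int c - 1) - 4 * int m) / ?d" for c
  define r where "r c = ?N * q powi ((int c - 1) * (2 * int c - 1))" for c
  define r' where "r' c = ?N * q powi (int c * (2 * int c - 1) - 2 * int m)" for c
  define A where "A c = (u c / ?d) *\<^sub>q raised (?s c + 2) a c 1 1 + u c *\<^sub>q ?M (?s c + 1) (Kinv * ?H c)
     + (v c / ?d) *\<^sub>q raised (?s c + 1) a c Kinv (q powi (-2))" for c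
  define B where "B c = b c *\<^sub>q prev_twisted (?s c + 2) a c 1
     + k c *\<^sub>q (prev_twisted (?s c + 2) a c 1 - prev_layer (?s c + 2) a c 1)
     + k' c *\<^sub>q (prev_twisted (?s c + 1) a c Kinv - prev_layer (?s c + 1) a c Kinv)
     - r c *\<^sub>q prev_layer (?s c + 2) a c 1 - r' c *\<^sub>q prev_layer (?s c + 1) a c Kinv" for c
  have step: "t * odd_term m c - ?N *\<^sub>q even_term m c = A c + B (Suc c)" for c
  proof -
    have 1: "t * layer 1 (?s c + 1) (?H c)
      = (1 / ?d) *\<^sub>q raised (?s c + 1 + 1) a c 1 1 + ?M (?s c + 1) (Kinv * ?H c)
      + (q powi (1 - (?s c + 1)) / ?d) *\<^sub>q (prev_twisted (?s c) a (Suc c) 1 - prev_layer (?s c) a (Suc c) 1)"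
      using t_layer_hbinom[of 1 1 "?s c + 1" a c] by simp
    have 2: "t * layer 1 (?s c) (Kinv * ?H c) = (1 / ?d) *\<^sub>q raised (?s c + 1) a c Kinv (q powi (-2))
      + prev_twisted (?s c) a (Suc c) 1
      + (q powi (1 - ?s c) / ?d) *\<^sub>q (prev_twisted (?s c - 1) a (Suc c) Kinv - prev_layer (?s c - 1) a (Suc c) Kinv)"
      using t_layer_hbinom[OF F_Kinv refl, of "?s c" a c] twisted_eq_prev_twisted[of "?s c" 1 a c]
      by (simp only: diff_add_cancel power2_eq_square mult.assoc mult_1_left)
    have e: "u c * (q powi (1 - (?s c + 1)) / ?d) = k (Suc c)"
      "v c * (q powi (1 - ?s c) / ?d) = k' (Suc c)"
      "v c = b (Suc c)"
      by (simp_all add: u_def v_def k_def k'_def b_def algebra_simps flip: power_int_add)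
    have s: "2 * int m + 1 - 2 * int c = ?s c + 1" "2 * int m - 1 - 2 * int c = ?s c - 1"
      and s': "?s c = ?s (Suc c) + 2" "?s (Suc c) + 2 - 1 = ?s (Suc c) + 1" "?s c + 1 + 1 = ?s c + 2"
      by simp_all
    have even: "?N *\<^sub>q even_term m c = r (Suc c) *\<^sub>q prev_layer (?s c) a (Suc c) 1
        + r' (Suc c) *\<^sub>q prev_layer (?s c - 1) a (Suc c) Kinv"
      using layer_eq_prev_layer[of "?s c" 1 a c]
      by (simp add: even_term_def s a_def[symmetric] layer_eq_prev_layer U.scale_right_distrib r_def r'_def
          algebra_simps)
    have "t * odd_term m c
      = u c *\<^sub>q ((1 / ?d) *\<^sub>q raised (?s c + 1 + 1) a c 1 1 + ?M (?s c + 1) (Kinv * ?H c)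
      + (q powi (1 - (?s c + 1)) / ?d) *\<^sub>q (prev_twisted (?s c) a (Suc c) 1 - prev_layer (?s c) a (Suc c) 1))
      + v c *\<^sub>q ((1 / ?d) *\<^sub>q raised (?s c + 1) a c Kinv (q powi (-2))
      + prev_twisted (?s c) a (Suc c) 1
      + (q powi (1 - ?s c) / ?d) *\<^sub>q
          (prev_twisted (?s c - 1) a (Suc c) Kinv - prev_layer (?s c - 1) a (Suc c) Kinv))"
      unfolding odd_term_def distrib_left[where 'a = U] scale_mult_right a_def[symmetric] s 1 2
      by (simp only: u_def v_def U.scale_right_distrib)
    then show ?thesis
      unfolding A_def B_def U.scale_right_distrib U.scale_scale e(1,2) even
      unfolding e(3)[symmetric] s'(3) unfolding s'(1,2)
      by (simp only: diff_conv_add_uminus minus_add_distrib add_ac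
          times_divide_eq_right mult_1_right)
  qed
  have match: "A c + B c = qint (2 * int m + 2) *\<^sub>q even_term (Suc m) c" for c
  proof -
    have s: "2 * int (Suc m) - 2 * int c = ?s c + 2" "2 * int (Suc m) - 1 - 2 * int c = ?s c + 1"
      by simp_all
    have 1: "(u c / ?d) *\<^sub>q raised (?s c + 2) a c 1 1 + b c *\<^sub>q prev_twisted (?s c + 2) a c 1
       + k c *\<^sub>q (prev_twisted (?s c + 2) a c 1 - prev_layer (?s c + 2) a c 1)
       - r c *\<^sub>q prev_layer (?s c + 2) a c 1
       = (qint (2 * int m + 2) * q powi (int c * (2 * int c + 1))) *\<^sub>q ?L (?s c + 2) (?H' c)"
    proof -
      have k: "u c / ?d * q powi (?s c + 2 + 1) = b c * q powi (4 - 4 * a) + k c * q powi (4 - 4 * a)"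
        using q_square_neq_1 unfolding k_def u_def b_def a_def
        by (simp add: divide_simps) (simp add: algebra_simps q_square_mult flip: power_int_add)
      have h: "u c / ?d * q powi (?s c + 2 + 1) - k c - r c = 0"
        using q_square_neq_1 unfolding k_def u_def b_def a_def r_def qint_eq
        by (simp add: divide_simps) (simp add: algebra_simps q_square_mult flip: power_int_add)
      have h': "(k c + r c) * q powi (4 * int c) - u c / ?d * (q powi (1 - (?s c + 2)) * 1)
          = qint (2 * int m + 2) * q powi (int c * (2 * int c + 1))"
        using q_square_neq_1 unfolding k_def u_def b_def a_def r_def qint_eq
        by (simp add: divide_simps) (simp add: algebra_simps q_square_mult flip: power_int_add)
      show ?thesis
        using match_layers[of "u c / ?d" "?s c + 2" "b c * q powi (4 - 4 * a)" "k c" a 1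
            "b c * q powi (4 - 4 * a)" c 1 "r c"] k
        unfolding h h' by (simp add: prev_twisted_def U.scale_right_diff_distrib)
    qed
    have 2: "(v c / ?d) *\<^sub>q raised (?s c + 1) a c Kinv (q powi (-2)) + u c *\<^sub>q ?M (?s c + 1) (Kinv * ?H c)
       + k' c *\<^sub>q (prev_twisted (?s c + 1) a c Kinv - prev_layer (?s c + 1) a c Kinv)
       - r' c *\<^sub>q prev_layer (?s c + 1) a c Kinv
       = (qint (2 * int m + 2) * q powi ((int c + 1) * (2 * int c + 1) - 2 * int (Suc m)))
           *\<^sub>q ?L (?s c + 1) (Kinv * ?H' c)"
    proof -
      have k: "v c / ?d * q powi (?s c + 1 + 1) = u c + k' c * q powi (4 - 4 * a)"
        "v c / ?d * q powi (?s c + 1 + 1) * q powi (-2) = 0 + k' c * q powi (4 - 4 * a)"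
        using q_square_neq_1 unfolding k'_def u_def v_def a_def
        by (simp_all add: divide_simps) (simp_all add: algebra_simps q_square_mult flip: power_int_add)
      have h: "v c / ?d * q powi (?s c + 1 + 1) - k' c - r' c = 0"
        using q_square_neq_1 unfolding k'_def u_def v_def a_def r'_def qint_eq
        by (simp add: divide_simps) (simp add: algebra_simps q_square_mult flip: power_int_add)
      have h': "(k' c + r' c) * q powi (4 * int c) - v c / ?d * (q powi (1 - (?s c + 1)) * q powi (-2))
          = qint (2 * int m + 2) * q powi ((int c + 1) * (2 * int c + 1) - 2 * int (Suc m))"
        using q_square_neq_1 unfolding k'_def u_def v_def a_def r'_def qint_eq
        by (simp add: divide_simps) (simp add: algebra_simps q_square_mult flip: power_int_add)
      show ?thesis
        using match_layers[OF k, of c Kinv "r' c"]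
        unfolding h h' by simp
    qed
    show ?thesis
      unfolding even_term_def s a' U.scale_right_distrib U.scale_scale 1[symmetric] 2[symmetric]
      by (simp add: A_def B_def)
  qed
  \<comment> \<open>The range is extended to \<open>Suc m\<close> because \<open>B (Suc m)\<close> contains layers of index \<open>0\<close>.\<close>
  have "t * (\<Sum>c\<le>m. odd_term m c) - ?N *\<^sub>q (\<Sum>c\<le>m. even_term m c)
      = (\<Sum>c\<le>Suc m. t * odd_term m c - ?N *\<^sub>q even_term m c)"
    by (simp add: terms_vanish sum_distrib_left U.scale_sum_right sum_subtractf)
  also have "\<dots> = (\<Sum>c\<le>Suc m. A c + B (Suc c))"
    by (simp only: step)
  also have "\<dots> = (\<Sum>c\<le>Suc m. A c + B c)"
    by (rule sum_shift_index) (simp_all add: B_def prev_neg)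
  also have "\<dots> = qint (2 * int m + 2) *\<^sub>q (\<Sum>c\<le>Suc m. even_term (Suc m) c)"
    by (simp only: match U.scale_sum_right)
  finally show ?thesis
    by (simp add: diff_eq_eq)
qed

lemma t_ev_eq_sum:
  "t_ev (2 * m) = (\<Sum>c\<le>m. even_term m c)"
  "t_ev (2 * m + 1) = (\<Sum>c\<le>m. odd_term m c)"
proof -
  have odd: "t_ev (2 * m + 1) = (\<Sum>c\<le>m. odd_term m c)"
    if "t_ev (2 * m) = (\<Sum>c\<le>m. even_term m c)" for m
  proof -
    have "qint (2 * int m + 1) \<noteq> 0"
      using qint_nonzero[of "2 * m + 1"] by (simp add: add.commute)
    with t_even_sum[of m] show ?thesis
      using t_ev_recurrences(1)[of m] unfolding that by (simp only: U.scale_left_imp_eq)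
  qed
  show even: "t_ev (2 * m) = (\<Sum>c\<le>m. even_term m c)"
  proof (induction m)
    case 0
    show ?case
      by (simp add: even_term_def layer_neg) (simp add: layer_def)
  next
    case (Suc m)
    have "qint (2 * int m + 2) \<noteq> 0"
      using qint_nonzero[of "2 * m + 2"] by (simp add: add.commute)
    moreover have "qint (2 * int m + 2) *\<^sub>q t_ev (2 * Suc m)
        = qint (2 * int m + 2) *\<^sub>q (\<Sum>c\<le>Suc m. even_term (Suc m) c)"
      using t_ev_recurrences(2)[of m] t_odd_sum[of m] unfolding odd[OF Suc.IH] Suc.IH by simp
    ultimately show ?case
      by (simp only: U.scale_left_imp_eq)
  qed
  show "t_ev (2 * m + 1) = (\<Sum>c\<le>m. odd_term m c)"
    by (rule odd[OF even])
qed

lemma scale_layer: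
  assumes "s = int n"
  shows "q powi e *\<^sub>q layer 1 s P = (\<Sum>a = 0..n. q powi (e - int a * (s - int a)) *\<^sub>q
     (dpow Echeck a * P * dpow F (n - a)))"
  using assms by (simp add: layer_def U.scale_sum_right power_int_add power_int_diff power_int_minus
      nat_add_distrib atLeast0AtMost lessThan_Suc_atMost divide_inverse)

theorem theorem4p1:
  fixes m :: nat
  shows
    "t_ev (2 * m) =
       (\<Sum>c = 0..m. \<Sum>a = 0..2 * m - 2 * c.
          (q powi (int ((2 * c + 1) choose 2) - int a * (2 * int m - 2 * int c - int a))) *\<^sub>q
            (dpow Echeck a * hbinom (1 - int m) c * dpow F (2 * m - 2 * c - a)))
     + (\<Sum>c \<in> {0..<m}. \<Sum>a = 0..2 * m - 1 - 2 * c.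
          (q powi (int ((2 * c + 2) choose 2) - 2 * int m
                     - int a * (2 * int m - 1 - 2 * int c - int a))) *\<^sub>q
            (dpow Echeck a * hbinom (1 - int m) c * Kinv * dpow F (2 * m - 1 - 2 * c - a)))
   \<and> t_ev (2 * m + 1) =
       (\<Sum>c = 0..m. \<Sum>a = 0..2 * m + 1 - 2 * c.
          (q powi (int ((2 * c) choose 2) - int a * (2 * int m + 1 - 2 * int c - int a))) *\<^sub>q
            (dpow Echeck a * hbinom (1 - int m) c * dpow F (2 * m + 1 - 2 * c - a)))
     + (\<Sum>c = 0..m. \<Sum>a = 0..2 * m - 2 * c.
          (q powi (int ((2 * c + 1) choose 2) - 2 * int m
                     - int a * (2 * int m - 2 * int c - int a))) *\<^sub>q
            (dpow Echeck a * hbinom (1 - int m) c * Kinv * dpow F (2 * m - 2 * c - a)))"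
proof -
  \<comment> \<open>It remains to write out the layers. In the even case the layer with \<open>K\<inverse>\<close> at \<open>c = m\<close> has
    index \<open>-1\<close> and drops out.\<close>
  have choose: "int ((2 * c + 1) choose 2) = int c * (2 * int c + 1)"
    "int ((2 * c + 2) choose 2) = (int c + 1) * (2 * int c + 1)"
    "int ((2 * c) choose 2) = int c * (2 * int c - 1)" for c
  proof -
    show "int ((2 * c + 1) choose 2) = int c * (2 * int c + 1)"
      by (simp add: choose_two algebra_simps)
    show "int ((2 * c + 2) choose 2) = (int c + 1) * (2 * int c + 1)"
      by (simp add: choose_two algebra_simps)
    show "int ((2 * c) choose 2) = int c * (2 * int c - 1)"
      by (cases c) (simp_all add: choose_two algebra_simps)
  qed
  have HK: "P * hbinom a c * Kinv * R = P * (Kinv * hbinom a c) * R" for P R a c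
    by (simp add: Kinv_hbinom mult.assoc)
  let ?L = "\<lambda>e s c. q powi e *\<^sub>q layer 1 s (hbinom (1 - int m) c)"
  let ?K = "\<lambda>e s c. q powi e *\<^sub>q layer 1 s (Kinv * hbinom (1 - int m) c)"
  have "t_ev (2 * m) = (\<Sum>c = 0..m. ?L (int c * (2 * int c + 1)) (2 * int m - 2 * int c) c)
     + (\<Sum>c \<in> {0..<m}. ?K ((int c + 1) * (2 * int c + 1) - 2 * int m) (2 * int m - 1 - 2 * int c) c)"
    unfolding t_ev_eq_sum(1) even_term_def sum.distrib
    by (simp add: atLeast0AtMost atLeast0LessThan layer_neg flip: lessThan_Suc_atMost)
  moreover have "t_ev (2 * m + 1) = (\<Sum>c = 0..m. ?L (int c * (2 * int c - 1)) (2 * int m + 1 - 2 * int c) c)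
     + (\<Sum>c = 0..m. ?K (int c * (2 * int c + 1) - 2 * int m) (2 * int m - 2 * int c) c)"
    unfolding t_ev_eq_sum(2) odd_term_def sum.distrib by (simp add: atLeast0AtMost)
  ultimately show ?thesis
    unfolding choose HK
    by (intro conjI)
      (elim ssubst, intro arg_cong2[where f = "(+)"] sum.cong refl scale_layer; simp add: of_nat_diff)+
qed

end
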